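(* Let $X$ be a stable matching different from $X^{\max}$. For each rotation $L\in\mathcal{L}(X)$, the matching $X':=(X\setminus L^-)\cup L^+$ is stable and satisfies $X'\succ_F X$.
   Context: Setting. $G=(V,E)$ is a finite bipartite graph without multiple edges, with vertex parts $W$ and $F$; the edge joining $w\in W$ and $f\in F$ is denoted $wf$. $E_v$ is the set of edges incident to $v\in V$, and $X_v:=X\cap E_v$ for $X\subseteq E$. Each $w\in W$ has a strict linear order $>_w$ on $E_w$ ($e>_w e'$ means that $e$ is preferred to $e'$) and quota $q(w)=1$; accordingly $C_w(Z)$, for nonempty $Z\subseteq E_w$, is the one-element set formed by the $>_w$-largest element of $Z$, and $C_w(\emptyset)=\emptyset$. Each $f\in F$ has a choice function $C_f:2^{E_f}\to 2^{E_f}$ with $C_f(Z)\subseteq Z$, satisfying for all $Z,Z'\subseteq E_f$: (A1) if $Z\supseteq Z'\supseteq C_f(Z)$ then $C_f(Z')=C_f(Z)$; (A2) if $Z\supseteq Z'$ then $C_f(Z)\cap Z'\subseteq C_f(Z')$; (A3) if $Z\supseteq Z'$ then $|C_f(Z)|\ge |C_f(Z')|$. Stability. A matching is an arbitrary subset $X\subseteq E$. A set $Z\subseteq E_v$ is acceptable if $C_v(Z)=Z$; $X\subseteq E$ is acceptable if all $X_v$, $v\in V$, are. For acceptable $Z,Z'\subseteq E_v$, $Z\succeq_v Z'$ means $C_v(Z\cup Z')=Z$. For distinct acceptable matchings $X,Y$, $X\succ_F Y$ (also written $X\succ Y$, or $Y\prec X$) means $X_f\succeq_f Y_f$ for all $f\in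 F$. An acceptable $X$ is stable if there is no edge $e=wf\in E\setminus X$ with both $e\in C_w(X_w\cup\{e\})$ and $e\in C_f(X_f\cup\{e\})$. $\mathcal{S}$ is the set of stable matchings. It is known that $\mathcal{S}\neq\emptyset$ and $(\mathcal{S},\prec_F)$ is a distributive lattice; its minimal and maximal elements are denoted $X^{\min}$, $X^{\max}$. Active graph and rotations. Let $X\in\mathcal{S}$. For $w\in W$ with $|X_w|=1$, let $x_w$ be the unique edge of $X_w$. If the set of edges $e=wf\in E_w$ with $x_w>_w e$ and $e\in C_f(X_f\cup\{e\})$ is nonempty, its $>_w$-largest element is called $W$-admissible and denoted $a_w$. If $a_w=wf$ and $C_f(X_f\cup\{a_w\})=(X_f\setminus\{e'\})\cup\{a_w\}$ for some $e'\in X_f$, then $e'$ is called $F$-admissible, is denoted $b^w_f$ and said to be associated with $a_w$, and $(a_w,b^w_f)$ is called a tandem passing $f$ (the only other possibility is $C_f(X_f\cup\{a_w\})=X_f\cup\{a_w\}$, when $a_w$ generates no tandem). Let $D(X)$ be the directed graph on $V$ whose edges are the $W$-admissible edges directed from $W$ to $F$ and the $F$-admissible edges directed from $F$ to $W$. Cleaning procedure: as long as the current graph has a vertex $w\in W$ with a leaving edge $a_w=(w,f)$ but no entering edge, delete $a_w$, and if $a_w$ has an associated edge $b^w_f$ which occurs in no other tandem passing $f$ in the current graph, delete $b^w_f$ as well; isolated vertices are removed. The final graph $\Gamma(X)$ is the active graph of $X$. In it every $w\in W$ that remains has exactly one entering and one leaving edge, and for every remaining $f\in F$ the tandems passing $f$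 partition the set of edges at $f$. Hence $\Gamma(X)$ decomposes uniquely into pairwise edge-disjoint directed cycles (edge-simple, possibly visiting a vertex of $F$ several times) which at each $w\in W$ go from the entering to the leaving edge, and at each visit to $f\in F$ traverse a tandem ($a_w$, then $b^w_f$). These cycles are the rotations generated by $X$; their set is $\mathcal{L}(X)$. For a rotation $L$, $L^+$ is the set of its edges going from $W$ to $F$ and $L^-$ the set of its edges going from $F$ to $W$ (both regarded as subsets of $E$). *)

theory Defs
  imports Main
begin

text \<open>
  The two vertex parts live in different types, so that a vertex has type \<open>'w + 'f\<close> and,
  as there are no multiple edges, the edge joining \<open>w\<close> and \<open>f\<close> is the pair \<open>(w, f)\<close>.
  \<open>(e, e') \<in> pref G w\<close> means that \<open>w\<close> prefers \<open>e\<close> to \<open>e'\<close>.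
\<close>

record ('w, 'f) market =
  partW :: "'w set"
  partF :: "'f set"
  edges :: "('w \<times> 'f) set"
  pref :: "'w \<Rightarrow> ('w \<times> 'f) rel"
  choiceF :: "'f \<Rightarrow> ('w \<times> 'f) set \<Rightarrow> ('w \<times> 'f) set"

fun incident :: "('w, 'f) market \<Rightarrow> 'w + 'f \<Rightarrow> ('w \<times> 'f) set" where
  "incident G (Inl w) = {e \<in> edges G. fst e = w}"
| "incident G (Inr f) = {e \<in> edges G. snd e = f}"

definition valid_market :: "('w, 'f) market \<Rightarrow> bool" where
  "valid_market G \<longleftrightarrow>
     finite (partW G) \<and> finite (partF G) \<and> edges G \<subseteq> partW G \<times> partF G \<and>
     (\<forall>w\<in>partW G. pref G w \<subseteq> incident G (Inl w) \<times> incident G (Inl w) \<and>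
        strict_linear_order_on (incident G (Inl w)) (pref G w)) \<and>
     (\<forall>f\<in>partF G. \<forall>Z \<subseteq> incident G (Inr f). choiceF G f Z \<subseteq> Z) \<and>
     (\<forall>f\<in>partF G. \<forall>Z Z'. Z' \<subseteq> Z \<and> Z \<subseteq> incident G (Inr f) \<longrightarrow>
        (choiceF G f Z \<subseteq> Z' \<longrightarrow> choiceF G f Z' = choiceF G f Z) \<and>
        choiceF G f Z \<inter> Z' \<subseteq> choiceF G f Z' \<and>
        card (choiceF G f Z') \<le> card (choiceF G f Z))"

fun choice :: "('w, 'f) market \<Rightarrow> 'w + 'f \<Rightarrow> ('w \<times> 'f) set \<Rightarrow> ('w \<times> 'f) set" where
  "choice G (Inl w) Z = {e \<in> Z. \<forall>e'\<in>Z. e' \<noteq> e \<longrightarrow> (e, e') \<in> pref G w}"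
| "choice G (Inr f) Z = choiceF G f Z"

definition acceptable_at :: "('w, 'f) market \<Rightarrow> 'w + 'f \<Rightarrow> ('w \<times> 'f) set \<Rightarrow> bool" where
  "acceptable_at G v Z \<longleftrightarrow> Z \<subseteq> incident G v \<and> choice G v Z = Z"

definition acceptable :: "('w, 'f) market \<Rightarrow> ('w \<times> 'f) set \<Rightarrow> bool" where
  "acceptable G X \<longleftrightarrow> X \<subseteq> edges G \<and>
     (\<forall>v \<in> partW G <+> partF G. acceptable_at G v (X \<inter> incident G v))"

definition prefers_at :: "('w, 'f) market \<Rightarrow> 'w + 'f \<Rightarrow> ('w \<times> 'f) set \<Rightarrow> ('w \<times> 'f) set \<Rightarrow> bool" where
  "prefers_at G v Z Z' \<longleftrightarrow>
     acceptable_at G v Z \<and> acceptable_at G v Z' \<and> choice G v (Z \<union> Z') = Z"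

definition succF :: "('w, 'f) market \<Rightarrow> ('w \<times> 'f) set \<Rightarrow> ('w \<times> 'f) set \<Rightarrow> bool" where
  "succF G X Y \<longleftrightarrow> X \<noteq> Y \<and> acceptable G X \<and> acceptable G Y \<and>
     (\<forall>f\<in>partF G. prefers_at G (Inr f) (X \<inter> incident G (Inr f)) (Y \<inter> incident G (Inr f)))"

definition stable_matching :: "('w, 'f) market \<Rightarrow> ('w \<times> 'f) set \<Rightarrow> bool" where
  "stable_matching G X \<longleftrightarrow> acceptable G X \<and>
     \<not> (\<exists>w f. (w, f) \<in> edges G - X \<and>
            (w, f) \<in> choice G (Inl w) (X \<inter> incident G (Inl w) \<union> {(w, f)}) \<and>
            (w, f) \<in> choice G (Inr f) (X \<inter> incident G (Inr f) \<union> {(w, f)}))"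

text \<open>
  The greatest element of the lattice of stable matchings; for a valid market it is known to
  exist.
\<close>

definition Xmax :: "('w, 'f) market \<Rightarrow> ('w \<times> 'f) set" where
  "Xmax G = (THE X. stable_matching G X \<and> (\<forall>Y. stable_matching G Y \<and> Y \<noteq> X \<longrightarrow> succF G X Y))"

definition candidates :: "('w, 'f) market \<Rightarrow> ('w \<times> 'f) set \<Rightarrow> 'w \<Rightarrow> ('w \<times> 'f) set" where
  "candidates G X w =
     {e \<in> incident G (Inl w).
        (the_elem (X \<inter> incident G (Inl w)), e) \<in> pref G w \<and>
        e \<in> choice G (Inr (snd e)) (X \<inter> incident G (Inr (snd e)) \<union> {e})}"

text \<open>
  The choice function of \<open>w\<close>, applied to the candidates at \<open>w\<close>, yields \<open>{a\<^sub>w}\<close>, or the empty set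
  if there are no candidates.
\<close>

definition W_admissible :: "('w, 'f) market \<Rightarrow> ('w \<times> 'f) set \<Rightarrow> ('w \<times> 'f) set" where
  "W_admissible G X =
     (\<Union>w \<in> {w \<in> partW G. card (X \<inter> incident G (Inl w)) = 1}. choice G (Inl w) (candidates G X w))"

definition tandem :: "('w, 'f) market \<Rightarrow> ('w \<times> 'f) set \<Rightarrow> 'w \<times> 'f \<Rightarrow> 'w \<times> 'f \<Rightarrow> bool" where
  "tandem G X a b \<longleftrightarrow> a \<in> W_admissible G X \<and>
     (let v = Inr (snd a); Xv = X \<inter> incident G v
      in b \<in> Xv \<and> choice G v (Xv \<union> {a}) = (Xv - {b}) \<union> {a})"

definition F_admissible :: "('w, 'f) market \<Rightarrow> ('w \<times> 'f) set \<Rightarrow> ('w \<times> 'f) set" where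
  "F_admissible G X = {b. \<exists>a. tandem G X a b}"

text \<open>
  A directed graph whose arcs are orientations of edges: \<open>to_F\<close> is the set of edges directed from
  \<open>W\<close> to \<open>F\<close>, \<open>to_W\<close> the set of those directed from \<open>F\<close> to \<open>W\<close>. Its vertices are the ends of its
  arcs, so isolated vertices never occur.  A rotation \<open>L\<close> is a directed graph of this kind, and
  \<open>L\<^sup>+\<close>, \<open>L\<^sup>-\<close> are \<open>to_F L\<close>, \<open>to_W L\<close>.
\<close>

record ('w, 'f) dgraph =
  to_F :: "('w \<times> 'f) set"
  to_W :: "('w \<times> 'f) set"

definition DX :: "('w, 'f) market \<Rightarrow> ('w \<times> 'f) set \<Rightarrow> ('w, 'f) dgraph" where
  "DX G X = \<lparr>to_F = W_admissible G X, to_W = F_admissible G X\<rparr>"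

definition tandem_in ::
  "('w, 'f) market \<Rightarrow> ('w \<times> 'f) set \<Rightarrow> ('w, 'f) dgraph \<Rightarrow> 'w \<times> 'f \<Rightarrow> 'w \<times> 'f \<Rightarrow> bool" where
  "tandem_in G X H a b \<longleftrightarrow> tandem G X a b \<and> a \<in> to_F H \<and> b \<in> to_W H"

inductive clean_step ::
  "('w, 'f) market \<Rightarrow> ('w \<times> 'f) set \<Rightarrow> ('w, 'f) dgraph \<Rightarrow> ('w, 'f) dgraph \<Rightarrow> bool"
  for G X where
  "\<lbrakk> (w, f) \<in> to_F H; \<not> (\<exists>f'. (w, f') \<in> to_W H) \<rbrakk> \<Longrightarrow>
   clean_step G X H
     \<lparr>to_F = to_F H - {(w, f)},
      to_W = to_W H - {b. tandem G X (w, f) b \<and> \<not> (\<exists>a. a \<noteq> (w, f) \<and> tandem_in G X H a b)}\<rparr>"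

text \<open>
  The final graph of the cleaning procedure does not depend on the order of the deletions, so
  this predicate determines \<open>\<Gamma>(X)\<close>.
\<close>

definition active_graph ::
  "('w, 'f) market \<Rightarrow> ('w \<times> 'f) set \<Rightarrow> ('w, 'f) dgraph \<Rightarrow> bool" where
  "active_graph G X H \<longleftrightarrow> (clean_step G X)\<^sup>*\<^sup>* (DX G X) H \<and> \<not> (\<exists>H'. clean_step G X H H')"

text \<open>
  \<open>L\<close> consists of the arcs of an edge-simple directed cycle
  \<open>a 0, b 0, a 1, b 1, \<dots>, a (n - 1), b (n - 1)\<close> of \<open>H\<close>: the \<open>i\<close>-th visit to \<open>F\<close> traverses the tandem
  \<open>(a i, b i)\<close>, and \<open>b i\<close> enters the vertex of \<open>W\<close> which the next edge \<open>a (i + 1)\<close> leaves.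
\<close>

definition tandem_cycle ::
  "('w, 'f) market \<Rightarrow> ('w \<times> 'f) set \<Rightarrow> ('w, 'f) dgraph \<Rightarrow> ('w, 'f) dgraph \<Rightarrow> bool" where
  "tandem_cycle G X H L \<longleftrightarrow>
     (\<exists>n a b. n > 0 \<and> inj_on a {..<n} \<and> inj_on b {..<n} \<and>
        (\<forall>i<n. tandem_in G X H (a i) (b i) \<and> fst (b i) = fst (a (Suc i mod n))) \<and>
        L = \<lparr>to_F = a ` {..<n}, to_W = b ` {..<n}\<rparr>)"

definition cycle_decomposition ::
  "('w, 'f) market \<Rightarrow> ('w \<times> 'f) set \<Rightarrow> ('w, 'f) dgraph \<Rightarrow> ('w, 'f) dgraph set \<Rightarrow> bool" where
  "cycle_decomposition G X H R \<longleftrightarrow>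
     (\<forall>L\<in>R. tandem_cycle G X H L) \<and>
     (\<forall>L\<in>R. \<forall>L'\<in>R. L \<noteq> L' \<longrightarrow> to_F L \<inter> to_F L' = {} \<and> to_W L \<inter> to_W L' = {}) \<and>
     (\<Union>L\<in>R. to_F L) = to_F H \<and> (\<Union>L\<in>R. to_W L) = to_W H"

text \<open>
  The active graph and its decomposition into cycles exist and are unique, so the existential
  quantifiers below just refer to them.
\<close>

definition rotations :: "('w, 'f) market \<Rightarrow> ('w \<times> 'f) set \<Rightarrow> ('w, 'f) dgraph set" where
  "rotations G X = {L. \<exists>H R. active_graph G X H \<and> cycle_decomposition G X H R \<and> L \<in> R}"

end

theory Submission
  imports Defs
begin

text \<open>
  Fix \<open>f\<close> and let \<open>A\<close>, \<open>B\<close> be the sets of edges at \<open>f\<close> which a rotation adds to and removes from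
  \<open>X\<close>.  By substitutability (A2), an edge rejected from \<open>X\<^sub>f \<union> {a}\<close> for one \<open>a \<in> A\<close> is still rejected
  from the larger set \<open>X\<^sub>f \<union> A\<close>, so \<open>f\<close> chooses from \<open>X\<^sub>f \<union> A\<close> no edge outside \<open>(X\<^sub>f - B) \<union> A\<close>.  The
  tandems match \<open>A\<close> bijectively with \<open>B\<close>, so the latter set is exactly as large as \<open>X\<^sub>f\<close>, and
  cardinal monotonicity (A3) leaves \<open>f\<close> no choice but to take all of it
  (\<open>choiceF_simultaneous_exchange\<close>).  This gives acceptability and the preference at \<open>f\<close>.  On the
  other side, the rotation enters and leaves the same vertices \<open>w\<close>, and each of them gives up its
  only edge \<open>x\<^sub>w\<close> for \<open>a\<^sub>w\<close> (\<open>incident_after_exchange\<close>).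

  For stability, consider an edge \<open>e = wf\<close> blocking the new matching.  As \<open>f\<close> is better off than
  before, \<open>f\<close> would accept \<open>e\<close> on top of \<open>X\<^sub>f\<close> as well (\<open>choiceF_accepts_at_worse_set\<close>).  Since \<open>X\<close> is
  stable, \<open>w\<close> then prefers \<open>x\<^sub>w\<close> to \<open>e\<close>, and so \<open>e\<close> is one of the candidates among which \<open>a\<^sub>w\<close> is
  the best.  Hence \<open>w\<close> refuses \<open>e\<close> whether it still holds \<open>x\<^sub>w\<close> or has moved to \<open>a\<^sub>w\<close>.
\<close>

section \<open>Consequences of the market axioms\<close>

context
  fixes G :: "('w, 'f) market"
  assumes valid: "valid_market G"
begin

lemma finite_incident: "finite (incident G v)"
proof -
  have "finite (edges G)"
    using valid unfolding valid_market_def by (meson finite_SigmaI finite_subset)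
  then show ?thesis by (cases v) simp_all
qed

lemma partW_if_edge: "e \<in> edges G \<Longrightarrow> fst e \<in> partW G"
  and partF_if_edge: "e \<in> edges G \<Longrightarrow> snd e \<in> partF G"
  using valid unfolding valid_market_def by auto

lemma choiceF_subset:
  assumes "f \<in> partF G" "Z \<subseteq> incident G (Inr f)"
  shows "choiceF G f Z \<subseteq> Z"
proof -
  have "\<forall>f\<in>partF G. \<forall>Z \<subseteq> incident G (Inr f). choiceF G f Z \<subseteq> Z"
    using valid unfolding valid_market_def by (elim conjE)
  then show ?thesis
    using assms by blast
qed

lemma
  assumes "f \<in> partF G" "Z \<subseteq> incident G (Inr f)" "Z' \<subseteq> Z"
  shows choiceF_consistent: "choiceF G f Z \<subseteq> Z' \<Longrightarrow> choiceF G f Z' = choiceF G f Z"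
    and choiceF_substitutable: "choiceF G f Z \<inter> Z' \<subseteq> choiceF G f Z'"
    and card_choiceF_mono: "card (choiceF G f Z') \<le> card (choiceF G f Z)"
proof -
  have "\<forall>f\<in>partF G. \<forall>Z Z'. Z' \<subseteq> Z \<and> Z \<subseteq> incident G (Inr f) \<longrightarrow>
      (choiceF G f Z \<subseteq> Z' \<longrightarrow> choiceF G f Z' = choiceF G f Z) \<and>
      choiceF G f Z \<inter> Z' \<subseteq> choiceF G f Z' \<and>
      card (choiceF G f Z') \<le> card (choiceF G f Z)"
    using valid unfolding valid_market_def by (elim conjE)
  from this[rule_format, OF assms(1) conjI[OF assms(3,2)]]
  show "choiceF G f Z \<subseteq> Z' \<Longrightarrow> choiceF G f Z' = choiceF G f Z"
    and "choiceF G f Z \<inter> Z' \<subseteq> choiceF G f Z'"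
    and "card (choiceF G f Z') \<le> card (choiceF G f Z)"
    by simp_all
qed

lemma strict_linear_pref:
  assumes "w \<in> partW G"
  shows "strict_linear_order_on (incident G (Inl w)) (pref G w)"
proof -
  have "\<forall>w\<in>partW G. pref G w \<subseteq> incident G (Inl w) \<times> incident G (Inl w) \<and>
      strict_linear_order_on (incident G (Inl w)) (pref G w)"
    using valid unfolding valid_market_def by (elim conjE)
  then show ?thesis
    using assms by blast
qed

lemma pref_irrefl: "w \<in> partW G \<Longrightarrow> (e, e) \<notin> pref G w"
  using strict_linear_pref unfolding strict_linear_order_on_def irrefl_def by blast

lemma pref_asym:
  assumes "w \<in> partW G" "(e, e') \<in> pref G w"
  shows "(e', e) \<notin> pref G w"
proof -
  have "trans (pref G w)"
    using strict_linear_pref[OF assms(1)] unfolding strict_linear_order_on_def by blast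
  then show ?thesis
    using pref_irrefl assms by (meson transE)
qed

lemma pref_total:
  assumes "w \<in> partW G" "e \<in> incident G (Inl w)" "e' \<in> incident G (Inl w)" "e \<noteq> e'"
  shows "(e, e') \<in> pref G w \<or> (e', e) \<in> pref G w"
  using strict_linear_pref[OF assms(1)] assms(2-4)
  unfolding strict_linear_order_on_def total_on_def by blast

lemma acceptable_at_W:
  "acceptable G X \<Longrightarrow> w \<in> partW G \<Longrightarrow> acceptable_at G (Inl w) (X \<inter> incident G (Inl w))"
  unfolding acceptable_def by (meson InlI)

lemma acceptable_at_F:
  "acceptable G X \<Longrightarrow> f \<in> partF G \<Longrightarrow> acceptable_at G (Inr f) (X \<inter> incident G (Inr f))"
  unfolding acceptable_def by (meson InrI)

text \<open>
  Quota one: two edges of an acceptable set at \<open>w\<close> would have to be preferred to each other.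
\<close>

lemma acceptable_at_W_unique:
  assumes "w \<in> partW G" "acceptable_at G (Inl w) Z" "x \<in> Z" "y \<in> Z"
  shows "x = y"
proof (rule ccontr)
  assume "x \<noteq> y"
  then have "(x, y) \<in> pref G w" "(y, x) \<in> pref G w"
    using assms unfolding acceptable_at_def by auto
  then show False
    using pref_asym[OF assms(1)] by blast
qed

section \<open>Choices of the vertices in \<open>F\<close>\<close>

text \<open>
  Each single exchange at \<open>f\<close> says which edge gets rejected; substitutability keeps all of these
  rejections in force when the exchanges are offered together, and a count shows that nothing
  else is rejected.
\<close>

lemma choiceF_simultaneous_exchange:
  assumes f: "f \<in> partF G"
    and Z: "Z \<subseteq> incident G (Inr f)" "choiceF G f Z = Z"
    and A: "A \<subseteq> incident G (Inr f)" "A \<inter> Z = {}"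
    and \<beta>: "inj_on \<beta> A" "\<beta> ` A \<subseteq> Z"
    and single: "\<And>a. a \<in> A \<Longrightarrow> choiceF G f (Z \<union> {a}) = Z - {\<beta> a} \<union> {a}"
  shows "choiceF G f (Z \<union> A) = Z - \<beta> ` A \<union> A"
proof (rule card_seteq)
  have ZA: "Z \<union> A \<subseteq> incident G (Inr f)"
    using Z A by blast
  have fin: "finite Z" "finite A"
    using Z(1) A(1) finite_incident by (meson finite_subset)+
  then show "finite (Z - \<beta> ` A \<union> A)" by simp
  have "\<beta> a \<notin> choiceF G f (Z \<union> A)" if "a \<in> A" for a
  proof -
    have "choiceF G f (Z \<union> A) \<inter> (Z \<union> {a}) \<subseteq> Z - {\<beta> a} \<union> {a}"
      using choiceF_substitutable[OF f ZA, of "Z \<union> {a}"] single[OF that] that by auto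
    moreover have "\<beta> a \<in> Z" "\<beta> a \<noteq> a"
      using \<beta>(2) A(2) that by (metis disjoint_iff image_subset_iff)+
    ultimately show ?thesis by auto
  qed
  then show "choiceF G f (Z \<union> A) \<subseteq> Z - \<beta> ` A \<union> A"
    using choiceF_subset[OF f ZA] by blast
  have "card (Z - \<beta> ` A \<union> A) = card (Z - \<beta> ` A) + card A"
    using fin A(2) by (intro card_Un_disjoint) auto
  also have "\<dots> = card Z - card (\<beta> ` A) + card (\<beta> ` A)"
    using fin \<beta> by (simp add: card_Diff_subset card_image)
  also have "\<dots> = card Z"
    using fin \<beta>(2) by (simp add: card_mono)
  also have "\<dots> \<le> card (choiceF G f (Z \<union> A))"
    using card_choiceF_mono[OF f ZA, of Z] Z(2) by simp
  finally show "card (Z - \<beta> ` A \<union> A) \<le> card (choiceF G f (Z \<union> A))" .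
qed

text \<open>
  If \<open>f\<close> did not take \<open>e\<close> from \<open>Y \<union> {e}\<close>, then by consistency (A1) it would choose \<open>C\<^sub>f(Y)\<close> both
  there and from \<open>C\<^sub>f(Y) \<union> {e}\<close>.  So it takes \<open>e\<close> from \<open>Y \<union> {e}\<close>, and by substitutability from
  the smaller set \<open>Z \<union> {e}\<close> too.
\<close>

lemma choiceF_accepts_at_worse_set:
  assumes f: "f \<in> partF G"
    and Y: "Y \<subseteq> incident G (Inr f)" "Z \<subseteq> Y"
    and e: "e \<in> incident G (Inr f)" "e \<in> choiceF G f (choiceF G f Y \<union> {e})"
  shows "e \<in> choiceF G f (Z \<union> {e})"
proof -
  have Ye: "Y \<union> {e} \<subseteq> incident G (Inr f)"
    using Y e by blast
  have "e \<in> choiceF G f (Y \<union> {e})"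
  proof (rule ccontr)
    assume no: "e \<notin> choiceF G f (Y \<union> {e})"
    then have "choiceF G f (Y \<union> {e}) \<subseteq> Y"
      using choiceF_subset[OF f Ye] by blast
    then have same: "choiceF G f Y = choiceF G f (Y \<union> {e})"
      by (intro choiceF_consistent[OF f Ye]) auto
    then have "choiceF G f (choiceF G f Y \<union> {e}) = choiceF G f (Y \<union> {e})"
      using choiceF_subset[OF f Y(1)] by (intro choiceF_consistent[OF f Ye]) auto
    then show False using no e(2) by simp
  qed
  then show ?thesis
    using choiceF_substitutable[OF f Ye, of "Z \<union> {e}"] Y(2) by auto
qed

section \<open>Admissible edges, tandems and cycles\<close>

lemma W_admissibleE:
  assumes "a \<in> W_admissible G X"
  obtains x where "a \<in> edges G" "X \<inter> incident G (Inl (fst a)) = {x}" "(x, a) \<in> pref G (fst a)"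
    "\<And>e. e \<in> candidates G X (fst a) \<Longrightarrow> e \<noteq> a \<Longrightarrow> (a, e) \<in> pref G (fst a)"
proof -
  obtain w where w: "card (X \<inter> incident G (Inl w)) = 1"
    and a: "a \<in> choice G (Inl w) (candidates G X w)"
    using assms unfolding W_admissible_def by auto
  obtain x where x: "X \<inter> incident G (Inl w) = {x}"
    using w by (meson card_1_singletonE)
  have "fst a = w" "a \<in> edges G" "(the_elem {x}, a) \<in> pref G w"
    using a x unfolding candidates_def by auto
  then show thesis
    using a x by (intro that[of x]) auto
qed

lemma W_admissible_notin:
  assumes "a \<in> W_admissible G X"
  shows "a \<notin> X"
proof
  assume "a \<in> X"
  from W_admissibleE[OF assms] obtain x where "a \<in> edges G"
    "X \<inter> incident G (Inl (fst a)) = {x}" "(x, a) \<in> pref G (fst a)"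
    by metis
  with \<open>a \<in> X\<close> have "(a, a) \<in> pref G (fst a)" by auto
  then show False
    using pref_irrefl partW_if_edge[OF \<open>a \<in> edges G\<close>] by blast
qed

lemma W_admissible_eqI:
  assumes a: "a \<in> W_admissible G X" and a': "a' \<in> W_admissible G X" and "fst a = fst a'"
  shows "a = a'"
proof -
  obtain w where w: "w \<in> partW G" "a \<in> choice G (Inl w) (candidates G X w)"
    using a unfolding W_admissible_def by auto
  obtain w' where w': "a' \<in> choice G (Inl w') (candidates G X w')"
    using a' unfolding W_admissible_def by auto
  have "w = fst a" "w' = fst a'"
    using w w' by (auto simp: candidates_def)
  then have "w' = w"
    using \<open>fst a = fst a'\<close> by simp
  show ?thesis
  proof (rule ccontr)
    assume "a \<noteq> a'"
    then have "(a, a') \<in> pref G w" "(a', a) \<in> pref G w"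
      using w(2) w' unfolding \<open>w' = w\<close> by auto
    then show False
      using pref_asym[OF w(1)] by blast
  qed
qed

lemma tandemD:
  assumes "tandem G X a b"
  shows "a \<in> W_admissible G X" "b \<in> X" "b \<in> edges G" "snd b = snd a"
    "choiceF G (snd a) (X \<inter> incident G (Inr (snd a)) \<union> {a})
       = X \<inter> incident G (Inr (snd a)) - {b} \<union> {a}"
  using assms unfolding tandem_def Let_def by auto

text \<open>
  A cycle of tandems as a set: its tandems give a bijection \<open>\<beta>\<close> from the added to the removed edges,
  and it enters and leaves the same vertices of the part \<open>W\<close>.  The exchange is local to the
  vertices, so this is all that it sees of the order along the cycle.
\<close>

lemma tandem_cycleE:
  assumes "tandem_cycle G X H L"
  obtains \<beta> where "to_F L \<noteq> {}" "inj_on \<beta> (to_F L)" "to_W L = \<beta> ` to_F L"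
    "\<And>a. a \<in> to_F L \<Longrightarrow> tandem G X a (\<beta> a)" "fst ` to_W L = fst ` to_F L"
proof -
  obtain n a b where n: "n > 0" and a: "inj_on a {..<n}" and b: "inj_on b {..<n}"
    and t: "\<And>i. i < n \<Longrightarrow> tandem_in G X H (a i) (b i)"
    and next_arc: "\<And>i. i < n \<Longrightarrow> fst (b i) = fst (a (Suc i mod n))"
    and L: "L = \<lparr>to_F = a ` {..<n}, to_W = b ` {..<n}\<rparr>"
    using assms unfolding tandem_cycle_def by auto
  define \<beta> where "\<beta> = b \<circ> the_inv_into {..<n} a"
  have \<beta>: "\<beta> (a i) = b i" if "i < n" for i
    using that a by (simp add: \<beta>_def the_inv_into_f_f)
  have "fst (a i) \<in> fst ` b ` {..<n}" if i: "i < n" for i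
  proof -
    \<comment> \<open>The index preceding \<open>i\<close> on the cycle.\<close>
    define j where "j = (if i = 0 then n - 1 else i - 1)"
    have "j < n" "Suc j mod n = i"
      using i n by (auto simp: j_def)
    then show ?thesis
      using next_arc[of j] by (metis image_eqI lessThan_iff)
  qed
  moreover have "fst (b i) \<in> fst ` a ` {..<n}" if "i < n" for i
    using next_arc[OF that] n by simp
  ultimately have "fst ` to_W L = fst ` to_F L"
    using L by auto
  moreover have "inj_on \<beta> (to_F L)"
    using L \<beta> b by (auto simp: inj_on_def)
  moreover have "to_W L = \<beta> ` to_F L"
    using L \<beta> by (simp add: image_image)
  moreover have "tandem G X a' (\<beta> a')" if "a' \<in> to_F L" for a'
    using that L \<beta> t unfolding tandem_in_def by auto
  ultimately show thesis
    using that[of \<beta>] L n by auto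
qed

text \<open>
  A vertex \<open>w\<close> which some added edge leaves is also entered by some removed edge; as \<open>X\<^sub>w\<close> is a
  singleton, the removed edge is all of \<open>X\<^sub>w\<close>.
\<close>

lemma incident_after_exchange:
  assumes A: "A \<subseteq> W_admissible G X" and B: "B \<subseteq> X" "B \<subseteq> edges G"
    and ends: "fst ` B = fst ` A" and a: "a \<in> A"
  shows "(X - B \<union> A) \<inter> incident G (Inl (fst a)) = {a}"
proof -
  obtain x where x: "a \<in> edges G" "X \<inter> incident G (Inl (fst a)) = {x}"
    using W_admissibleE A a by (metis subsetD)
  obtain b where "b \<in> B" "fst b = fst a"
    using ends a by (metis image_iff)
  then have "x \<in> B"
    using B x by auto
  then have "X \<inter> incident G (Inl (fst a)) \<subseteq> B"
    using x(2) by simp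
  moreover have "A \<inter> incident G (Inl (fst a)) = {a}"
  proof -
    have "a' = a" if "a' \<in> A" "fst a' = fst a" for a'
      using that A a W_admissible_eqI by blast
    then show ?thesis
      using a x(1) by auto
  qed
  ultimately show ?thesis
    by blast
qed

text \<open>
  An edge that the \<open>F\<close>-side would accept on top of a stable \<open>X\<close> does not block, so its end in \<open>W\<close>
  holds a better edge.
\<close>

lemma stable_candidate:
  assumes X: "stable_matching G X" and e: "e \<in> edges G" "e \<notin> X"
    and acc: "e \<in> choiceF G (snd e) (X \<inter> incident G (Inr (snd e)) \<union> {e})"
  obtains x where "X \<inter> incident G (Inl (fst e)) = {x}" "(x, e) \<in> pref G (fst e)"
    "e \<in> candidates G X (fst e)"
proof -
  let ?Xw = "X \<inter> incident G (Inl (fst e))"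
  have w: "fst e \<in> partW G"
    using e(1) by (rule partW_if_edge)
  then have "acceptable_at G (Inl (fst e)) ?Xw"
    using X unfolding stable_matching_def by (intro acceptable_at_W) simp_all
  then have unique: "x = y" if "x \<in> ?Xw" "y \<in> ?Xw" for x y
    using acceptable_at_W_unique[OF w] that by blast
  have "e \<notin> choice G (Inl (fst e)) (?Xw \<union> {e})"
    using X e acc unfolding stable_matching_def by (cases e) auto
  then obtain x where x: "x \<in> ?Xw" "x \<noteq> e" "(e, x) \<notin> pref G (fst e)"
    by auto
  have "?Xw = {x}"
    using x unique by blast
  moreover have "(x, e) \<in> pref G (fst e)"
    using pref_total[OF w, of x e] x e by auto
  ultimately show thesis
    using e acc by (intro that[of x]) (auto simp: candidates_def)
qed

section \<open>The exchange along a cycle of tandems\<close>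

lemma tandem_cycle_exchange:
  assumes X: "stable_matching G X" and L: "tandem_cycle G X H L"
  shows "stable_matching G (X - to_W L \<union> to_F L)"
    and "succF G (X - to_W L \<union> to_F L) X"
proof -
  define A B X' where "A = to_F L" and "B = to_W L" and "X' = X - B \<union> A"
  obtain \<beta> where nonempty: "A \<noteq> {}" and inj: "inj_on \<beta> A" and B: "B = \<beta> ` A"
    and tandem: "\<And>a. a \<in> A \<Longrightarrow> tandem G X a (\<beta> a)" and ends: "fst ` B = fst ` A"
    using tandem_cycleE[OF L] unfolding A_def B_def by metis
  have accX: "acceptable G X"
    using X unfolding stable_matching_def by blast
  then have XE: "X \<subseteq> edges G"
    unfolding acceptable_def by blast
  have admissible: "A \<subseteq> W_admissible G X"
    using tandem tandemD(1) by blast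
  then have AE: "A \<subseteq> edges G"
    using W_admissibleE by blast
  have disjoint: "A \<inter> X = {}"
    using admissible W_admissible_notin by blast
  have BX: "B \<subseteq> X"
    using tandem tandemD(2) B by blast
  have X'E: "X' \<subseteq> edges G"
    unfolding X'_def using XE AE by blast

  have union: "X' \<inter> incident G v \<union> X \<inter> incident G v = X \<inter> incident G v \<union> A \<inter> incident G v" for v
    unfolding X'_def using BX by blast
  have chosen: "choiceF G f (X \<inter> incident G (Inr f) \<union> A \<inter> incident G (Inr f))
      = X' \<inter> incident G (Inr f)" if f: "f \<in> partF G" for f
  proof -
    let ?I = "incident G (Inr f)"
    \<comment> \<open>Both edges of a tandem lie at the same \<open>f\<close>, so \<open>\<beta>\<close> restricts to the edges at \<open>f\<close>.\<close>
    have image: "\<beta> ` (A \<inter> ?I) = B \<inter> ?I"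
      using tandemD(3,4)[OF tandem] AE B by auto
    have "choiceF G f (X \<inter> ?I \<union> A \<inter> ?I) = X \<inter> ?I - \<beta> ` (A \<inter> ?I) \<union> A \<inter> ?I"
    proof (rule choiceF_simultaneous_exchange[OF f])
      show "choiceF G f (X \<inter> ?I) = X \<inter> ?I"
        using acceptable_at_F[OF accX f] unfolding acceptable_at_def by simp
      show "A \<inter> ?I \<inter> (X \<inter> ?I) = {}"
        using disjoint by blast
      show "inj_on \<beta> (A \<inter> ?I)"
        using inj by (rule inj_on_subset) blast
      show "\<beta> ` (A \<inter> ?I) \<subseteq> X \<inter> ?I"
        using image BX by blast
      show "choiceF G f (X \<inter> ?I \<union> {a}) = X \<inter> ?I - {\<beta> a} \<union> {a}" if "a \<in> A \<inter> ?I" for a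
        using tandemD(5)[OF tandem, of a] that by auto
    qed auto
    then show ?thesis
      using image unfolding X'_def by blast
  qed

  have at_added: "X' \<inter> incident G (Inl (fst a)) = {a}" if "a \<in> A" for a
    unfolding X'_def using incident_after_exchange[OF admissible BX _ ends that] BX XE by blast
  have elsewhere: "X' \<inter> incident G (Inl w) = X \<inter> incident G (Inl w)" if "w \<notin> fst ` A" for w
    unfolding X'_def using that ends by auto

  have accF: "acceptable_at G (Inr f) (X' \<inter> incident G (Inr f))" if f: "f \<in> partF G" for f
  proof -
    let ?I = "incident G (Inr f)"
    have "choiceF G f (X' \<inter> ?I) = choiceF G f (X \<inter> ?I \<union> A \<inter> ?I)"
    proof (rule choiceF_consistent[OF f])
      show "X' \<inter> ?I \<subseteq> X \<inter> ?I \<union> A \<inter> ?I"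
        using union[of "Inr f"] by blast
    qed (use chosen[OF f] in auto)
    then show ?thesis
      using chosen[OF f] unfolding acceptable_at_def by auto
  qed
  have accW: "acceptable_at G (Inl w) (X' \<inter> incident G (Inl w))" if w: "w \<in> partW G" for w
  proof (cases "w \<in> fst ` A")
    case True
    then obtain a where "a \<in> A" "X' \<inter> incident G (Inl w) = {a}"
      using at_added by auto
    then show ?thesis unfolding acceptable_at_def by auto
  next
    case False
    then show ?thesis
      using elsewhere acceptable_at_W[OF accX w] by simp
  qed
  have accX': "acceptable G X'"
    unfolding acceptable_def using X'E accF accW by blast

  have "\<not> ((w, f) \<in> edges G - X' \<and>
      (w, f) \<in> choice G (Inl w) (X' \<inter> incident G (Inl w) \<union> {(w, f)}) \<and>
      (w, f) \<in> choice G (Inr f) (X' \<inter> incident G (Inr f) \<union> {(w, f)}))" for w f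
  proof
    define e where "e = (w, f)"
    assume "(w, f) \<in> edges G - X' \<and>
      (w, f) \<in> choice G (Inl w) (X' \<inter> incident G (Inl w) \<union> {(w, f)}) \<and>
      (w, f) \<in> choice G (Inr f) (X' \<inter> incident G (Inr f) \<union> {(w, f)})"
    then have e: "e \<in> edges G" "e \<notin> X'"
      and blockW: "e \<in> choice G (Inl w) (X' \<inter> incident G (Inl w) \<union> {e})"
      and blockF: "e \<in> choiceF G f (X' \<inter> incident G (Inr f) \<union> {e})"
      by (auto simp: e_def)
    let ?I = "incident G (Inr f)"
    have w: "w \<in> partW G" and f: "f \<in> partF G"
      using partW_if_edge[OF e(1)] partF_if_edge[OF e(1)] by (auto simp: e_def)
    have eI: "e \<in> ?I"
      using e by (simp add: e_def)
    have acc: "e \<in> choiceF G f (Z \<union> {e})" if "Z \<subseteq> X \<inter> ?I \<union> A \<inter> ?I" for Z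
    proof (rule choiceF_accepts_at_worse_set[OF f _ that eI])
      show "e \<in> choiceF G f (choiceF G f (X \<inter> ?I \<union> A \<inter> ?I) \<union> {e})"
        using blockF chosen[OF f] by simp
    qed blast
    have "e \<notin> X"
    proof
      \<comment> \<open>A removed edge would be accepted from \<open>X\<^sub>f \<union> A\<^sub>f\<close>, where it is rejected.\<close>
      assume "e \<in> X"
      then have "X \<inter> ?I \<union> A \<inter> ?I \<union> {e} = X \<inter> ?I \<union> A \<inter> ?I"
        using eI by blast
      then have "e \<in> X'"
        using acc[of "X \<inter> ?I \<union> A \<inter> ?I"] chosen[OF f] by auto
      then show False using e(2) by blast
    qed
    moreover have "e \<in> choiceF G (snd e) (X \<inter> incident G (Inr (snd e)) \<union> {e})"
      using acc[of "X \<inter> ?I"] by (simp add: e_def)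
    ultimately obtain x where x: "X \<inter> incident G (Inl w) = {x}" "(x, e) \<in> pref G w"
      "e \<in> candidates G X w"
      using stable_candidate[OF X e(1)] by (auto simp: e_def)
    \<comment> \<open>Either \<open>w\<close> has moved to \<open>a\<^sub>w\<close>, which beats all candidates, or it still holds \<open>x\<^sub>w\<close>.\<close>
    have "\<exists>y. X' \<inter> incident G (Inl w) = {y} \<and> y \<noteq> e \<and> (y, e) \<in> pref G w"
    proof (cases "w \<in> fst ` A")
      case True
      then obtain a where a: "a \<in> A" "fst a = w" by auto
      then have "a \<noteq> e"
        using e(2) unfolding X'_def by blast
      then have "(a, e) \<in> pref G w"
        using W_admissibleE[of a X] admissible a x(3) by (metis subsetD)
      then show ?thesis
        using at_added[OF a(1)] a(2) \<open>a \<noteq> e\<close> by blast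
    next
      case False
      then show ?thesis
        using elsewhere x \<open>e \<notin> X\<close> by auto
    qed
    then obtain y where "X' \<inter> incident G (Inl w) = {y}" "y \<noteq> e" "(y, e) \<in> pref G w"
      by blast
    then show False
      using blockW pref_asym[OF w, of y e] by auto
  qed
  then show "stable_matching G (X - to_W L \<union> to_F L)"
    using accX' unfolding stable_matching_def X'_def A_def B_def by blast

  have "prefers_at G (Inr f) (X' \<inter> incident G (Inr f)) (X \<inter> incident G (Inr f))"
    if f: "f \<in> partF G" for f
  proof -
    have "acceptable_at G (Inr f) (X \<inter> incident G (Inr f))"
      using accX f by (rule acceptable_at_F)
    moreover have "choice G (Inr f) (X' \<inter> incident G (Inr f) \<union> X \<inter> incident G (Inr f))
        = X' \<inter> incident G (Inr f)"
      using chosen[OF f] by (simp only: union choice.simps)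
    ultimately show ?thesis
      using accF[OF f] unfolding prefers_at_def by blast
  qed
  moreover have "X' \<noteq> X"
    unfolding X'_def using nonempty disjoint by blast
  ultimately show "succF G (X - to_W L \<union> to_F L) X"
    using accX' accX unfolding succF_def X'_def A_def B_def by simp
qed

end

theorem proposition3p1:
  fixes G :: "('w, 'f) market" and X :: "('w \<times> 'f) set" and L :: "('w, 'f) dgraph"
  assumes "valid_market G"
    and "stable_matching G X"
    and "X \<noteq> Xmax G"
    and "L \<in> rotations G X"
  shows "stable_matching G ((X - to_W L) \<union> to_F L) \<and> succF G ((X - to_W L) \<union> to_F L) X"
proof -
  obtain H R where "cycle_decomposition G X H R" "L \<in> R"
    using assms(4) unfolding rotations_def by auto
  then have "tandem_cycle G X H L"
    unfolding cycle_decomposition_def by simp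
  then show ?thesis
    using tandem_cycle_exchange[OF assms(1,2)] by blast
qed

end
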